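(* Let $x=\{x_t\}_{t\in\mathbb{R}}$ be a reflection-positive real-valued stochastic process, and let $\phi_\theta:\mathbb{R}\to\mathbb{R}$ be a family of bounded measurable random functions realized by a neural network architecture with parameters $\theta$ and parameter density $P(\theta)$. Then the stochastic process $y_t=\phi_\theta(x_t)$ is also reflection positive.
   Context: Reflection positivity: a real-valued process $\{z_t\}_{t\in\mathbb{R}}$ is reflection positive if for every $n\ge1$, all times $t_1,\dots,t_n>0$ and every bounded measurable function $F:\mathbb{R}^n\to\mathbb{C}$, $$\Big\langle F\big(z_{t_1},\dots,z_{t_n}\big)\,\big(F(z_{-t_1},\dots,z_{-t_n})\big)^*\Big\rangle\ \ge\ 0,$$ where $\langle\cdot\rangle$ is expectation, $^*$ is complex conjugation, and "$\ge0$" means real and non-negative. A neural network is a family of functions $\phi_\theta$ indexed by parameters $\theta$ in a measurable space, with a probability density $P(\theta)$ on the parameters; $(\theta,u)\mapsto\phi_\theta(u)$ is jointly measurable, and for each fixed $\theta$ the function $\phi_\theta$ is bounded and measurable. A sample path of $y_t=\phi_\theta(x_t)$ is generated by drawing an entire realization of the process $x$ and, independently, one draw of $\theta$ from $P(\theta)$ (the same $\theta$ for all times), and then applying $\phi_\theta$ pointwise in $t$. *)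

theory Defs
  imports "HOL-Probability.Probability"
begin

definition real_process :: "'w measure \<Rightarrow> (real \<Rightarrow> 'w \<Rightarrow> real) \<Rightarrow> bool" where
  "real_process M z \<longleftrightarrow> prob_space M \<and> (\<forall>t. z t \<in> borel_measurable M)"

text \<open>\<open>\<real>\<^sup>n\<close> is the space of extensional functions on \<open>{..<n}\<close> with its product Borel
  sigma-algebra. The times need not be distinct.\<close>

definition reflection_positive :: "'w measure \<Rightarrow> (real \<Rightarrow> 'w \<Rightarrow> real) \<Rightarrow> bool" where
  "reflection_positive M z \<longleftrightarrow> real_process M z \<and>
    (\<forall>n\<ge>1. \<forall>t :: nat \<Rightarrow> real. \<forall>F :: (nat \<Rightarrow> real) \<Rightarrow> complex.
      (\<forall>i<n. 0 < t i) \<longrightarrow>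
      F \<in> borel_measurable (\<Pi>\<^sub>M i\<in>{..<n}. borel) \<longrightarrow>
      bounded (F ` space (\<Pi>\<^sub>M i\<in>{..<n}. (borel :: real measure))) \<longrightarrow>
      (\<integral>w. F (\<lambda>i\<in>{..<n}. z (t i) w) * cnj (F (\<lambda>i\<in>{..<n}. z (- t i) w)) \<partial>M) \<in> \<real>\<^sub>\<ge>\<^sub>0)"

text \<open>The density \<open>P\<close> is taken with respect to an arbitrary reference measure \<open>N\<close> on the
  parameter space.\<close>

locale neural_network =
  fixes N :: "'p measure" and P :: "'p \<Rightarrow> real" and \<phi> :: "'p \<Rightarrow> real \<Rightarrow> real"
  assumes density_measurable: "P \<in> borel_measurable N"
    and density_nonneg: "\<And>\<theta>. \<theta> \<in> space N \<Longrightarrow> 0 \<le> P \<theta>"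
    and density_total: "(\<integral>\<^sup>+\<theta>. ennreal (P \<theta>) \<partial>N) = 1"
    and jointly_measurable: "(\<lambda>(\<theta>, u). \<phi> \<theta> u) \<in> borel_measurable (N \<Otimes>\<^sub>M borel)"
    and network_measurable: "\<And>\<theta>. \<theta> \<in> space N \<Longrightarrow> \<phi> \<theta> \<in> borel_measurable borel"
    and network_bounded: "\<And>\<theta>. \<theta> \<in> space N \<Longrightarrow> bounded (range (\<phi> \<theta>))"

text \<open>\<open>\<Theta>\<close> is independent of the whole path of \<open>x\<close>. The constant \<open>indep_var\<close> is not
  applicable, because it requires both random variables to take values in the same type.\<close>

definition indep_of_path ::
    "'w measure \<Rightarrow> (real \<Rightarrow> 'w \<Rightarrow> real) \<Rightarrow> 'p measure \<Rightarrow> ('w \<Rightarrow> 'p) \<Rightarrow> bool" where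
  "indep_of_path M x N \<Theta> \<longleftrightarrow>
    prob_space.indep_set M
      {(\<lambda>w t. x t w) -` A \<inter> space M | A. A \<in> sets (\<Pi>\<^sub>M t\<in>(UNIV :: real set). (borel :: real measure))}
      {\<Theta> -` B \<inter> space M | B. B \<in> sets N}"

end

theory Submission
  imports Defs
begin

text \<open>Independence makes the joint law of \<open>\<Theta>\<close> and the path a product measure, so by Fubini the
  reflection form of \<open>y\<close> at \<open>F\<close> is the average over \<open>\<theta>\<close> of the reflection forms of \<open>x\<close> at
  \<open>F\<^sub>\<theta>(a\<^sub>1, \<dots>, a\<^sub>n) = F (\<phi>\<^sub>\<theta>(a\<^sub>1), \<dots>, \<phi>\<^sub>\<theta>(a\<^sub>n))\<close>. For a fixed \<open>\<theta>\<close> this \<open>F\<^sub>\<theta>\<close> is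
  again bounded and measurable, so each of these forms is nonnegative.\<close>

text \<open>Such an \<open>f\<close> is the complex embedding of its real part, so its integral is
  the embedding of the integral of a nonnegative real function. The argument covers a non-integrable
  \<open>f\<close> as well: both integrals are then 0 by convention.\<close>

lemma integral_in_nonneg_Reals:
  fixes f :: "'a \<Rightarrow> complex"
  assumes "\<And>x. x \<in> space M \<Longrightarrow> f x \<in> \<real>\<^sub>\<ge>\<^sub>0"
  shows "(\<integral>x. f x \<partial>M) \<in> \<real>\<^sub>\<ge>\<^sub>0"
proof -
  have f: "f x = of_real (Re (f x))" "0 \<le> Re (f x)" if "x \<in> space M" for x
    using assms[OF that] by (auto elim: nonneg_Reals_cases)
  have "(\<integral>x. f x \<partial>M) = (\<integral>x. of_real (Re (f x)) \<partial>M)"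
    by (rule Bochner_Integration.integral_cong) (use f(1) in auto)
  also have "\<dots> = of_real (\<integral>x. Re (f x) \<partial>M)"
    by (rule integral_complex_of_real)
  finally show ?thesis
    using f(2) by simp
qed

text \<open>A product of sigma-finite measures is determined by its values on rectangles
  \<open>A \<times> B\<close>, and there independence is exactly the required product
  formula.\<close>

lemma (in prob_space) distr_Pair_indep_set:
  assumes X: "X \<in> measurable M S" and Y: "Y \<in> measurable M T"
    and indep: "indep_set {X -` A \<inter> space M | A. A \<in> sets S} {Y -` B \<inter> space M | B. B \<in> sets T}"
  shows "distr M (S \<Otimes>\<^sub>M T) (\<lambda>w. (X w, Y w)) = distr M S X \<Otimes>\<^sub>M distr M T Y"
proof (rule pair_measure_eqI[symmetric])
  note [measurable] = X Y
  show "sigma_finite_measure (distr M S X)" "sigma_finite_measure (distr M T Y)"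
    by (auto intro!: prob_space_imp_sigma_finite prob_space_distr)
  show "sets (distr M S X \<Otimes>\<^sub>M distr M T Y) = sets (distr M (S \<Otimes>\<^sub>M T) (\<lambda>w. (X w, Y w)))"
    by (simp cong: sets_pair_measure_cong)
  fix A B assume "A \<in> sets (distr M S X)" "B \<in> sets (distr M T Y)"
  then have [measurable]: "A \<in> sets S" "B \<in> sets T"
    by auto
  have "prob ((X -` A \<inter> space M) \<inter> (Y -` B \<inter> space M)) =
      prob (X -` A \<inter> space M) * prob (Y -` B \<inter> space M)"
    by (rule indep_setD[OF indep]) auto
  moreover have "(\<lambda>w. (X w, Y w)) -` (A \<times> B) \<inter> space M =
      (X -` A \<inter> space M) \<inter> (Y -` B \<inter> space M)"
    by auto
  ultimately show "emeasure (distr M S X) A * emeasure (distr M T Y) B =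
      emeasure (distr M (S \<Otimes>\<^sub>M T) (\<lambda>w. (X w, Y w))) (A \<times> B)"
    by (simp add: emeasure_distr emeasure_eq_measure ennreal_mult)
qed

text \<open>Fubini for the product law of \<open>X\<close> and \<open>Y\<close>; the uniform bound
  \<open>K\<close> gives integrability, as the product is a probability measure. The law of
  \<open>Y\<close> is integrated last, so that the inner integral sees \<open>X\<close> with a
  frozen value \<open>b\<close>.\<close>

lemma (in prob_space) integral_indep_set:
  fixes h :: "'b \<Rightarrow> 'c \<Rightarrow> 'd :: {banach, second_countable_topology}"
  assumes X: "X \<in> measurable M S" and Y: "Y \<in> measurable M T"
    and indep: "indep_set {X -` A \<inter> space M | A. A \<in> sets S} {Y -` B \<inter> space M | B. B \<in> sets T}"
    and h: "case_prod h \<in> borel_measurable (S \<Otimes>\<^sub>M T)"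
    and bound: "\<And>a b. a \<in> space S \<Longrightarrow> b \<in> space T \<Longrightarrow> norm (h a b) \<le> K"
  shows "(\<integral>w. h (X w) (Y w) \<partial>M) = (\<integral>b. (\<integral>w. h (X w) b \<partial>M) \<partial>distr M T Y)"
proof -
  note [measurable] = X Y
  interpret S: prob_space "distr M S X"
    by (rule prob_space_distr) fact
  interpret T: prob_space "distr M T Y"
    by (rule prob_space_distr) fact
  interpret ST: pair_prob_space "distr M S X" "distr M T Y" ..
  have sets: "sets (distr M S X \<Otimes>\<^sub>M distr M T Y) = sets (S \<Otimes>\<^sub>M T)"
    by (simp cong: sets_pair_measure_cong)
  have int: "integrable (distr M S X \<Otimes>\<^sub>M distr M T Y) (case_prod h)"
  proof (rule ST.P.integrable_const_bound[where B = K])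
    show "AE p in distr M S X \<Otimes>\<^sub>M distr M T Y. norm (case_prod h p) \<le> K"
      using bound by (intro AE_I2) (auto simp: space_pair_measure)
    show "case_prod h \<in> borel_measurable (distr M S X \<Otimes>\<^sub>M distr M T Y)"
      using h by (simp add: measurable_cong_sets[OF sets refl])
  qed
  have "(\<integral>w. h (X w) (Y w) \<partial>M) = (\<integral>p. case_prod h p \<partial>distr M (S \<Otimes>\<^sub>M T) (\<lambda>w. (X w, Y w)))"
    using h by (subst integral_distr) auto
  also have "\<dots> = (\<integral>p. case_prod h p \<partial>(distr M S X \<Otimes>\<^sub>M distr M T Y))"
    by (simp only: distr_Pair_indep_set[OF X Y indep])
  also have "\<dots> = (\<integral>b. (\<integral>a. h a b \<partial>distr M S X) \<partial>distr M T Y)"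
    using ST.integral_snd[OF int] by simp
  \<comment> \<open>Each section of \<open>h\<close> at a fixed \<open>b\<close> is measurable, so
    the inner integral over the law of \<open>X\<close> pulls back to \<open>M\<close>.\<close>
  also have "\<dots> = (\<integral>b. (\<integral>w. h (X w) b \<partial>M) \<partial>distr M T Y)"
  proof (rule Bochner_Integration.integral_cong[OF refl])
    fix b assume "b \<in> space (distr M T Y)"
    then have "(\<lambda>a. h a b) \<in> borel_measurable S"
      using measurable_compose[OF measurable_Pair2' h, of b] by simp
    then show "(\<integral>a. h a b \<partial>distr M S X) = (\<integral>w. h (X w) b \<partial>M)"
      by (subst integral_distr) auto
  qed
  finally show ?thesis .
qed

theorem theorem4p1:
  fixes M :: "'w measure" and x :: "real \<Rightarrow> 'w \<Rightarrow> real"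
    and N :: "'p measure" and P :: "'p \<Rightarrow> real" and \<phi> :: "'p \<Rightarrow> real \<Rightarrow> real"
    and \<Theta> :: "'w \<Rightarrow> 'p"
  assumes "reflection_positive M x"
    and "neural_network N P \<phi>"
    and "distributed M N \<Theta> (\<lambda>\<theta>. ennreal (P \<theta>))"
    and "indep_of_path M x N \<Theta>"
  shows "reflection_positive M (\<lambda>t w. \<phi> (\<Theta> w) (x t w))"
proof -
  interpret neural_network N P \<phi> by fact
  interpret prob_space M
    using assms(1) by (simp add: reflection_positive_def real_process_def)
  have x [measurable]: "x t \<in> borel_measurable M" for t
    using assms(1) by (simp add: reflection_positive_def real_process_def)
  have \<Theta> [measurable]: "\<Theta> \<in> measurable M N"
    using assms(3) by (simp add: distributed_def)
  note [measurable] = jointly_measurable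
  let ?path = "\<Pi>\<^sub>M t\<in>(UNIV :: real set). (borel :: real measure)"
  have path: "(\<lambda>w t. x t w) \<in> measurable M ?path"
    by (rule measurable_PiM_single') auto
  show ?thesis
    unfolding reflection_positive_def real_process_def
  proof (intro conjI allI impI)
    show "prob_space M"
      by (rule prob_space_axioms)
    show "(\<lambda>w. \<phi> (\<Theta> w) (x t w)) \<in> borel_measurable M" for t
      by measurable
    fix n :: nat and t :: "nat \<Rightarrow> real" and F :: "(nat \<Rightarrow> real) \<Rightarrow> complex"
    assume n: "1 \<le> n" and t: "\<forall>i<n. 0 < t i"
      and F [measurable]: "F \<in> borel_measurable (\<Pi>\<^sub>M i\<in>{..<n}. borel)"
      and "bounded (F ` space (\<Pi>\<^sub>M i\<in>{..<n}. (borel :: real measure)))"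
    then obtain K where K: "\<And>a. a \<in> space (\<Pi>\<^sub>M i\<in>{..<n}. (borel :: real measure)) \<Longrightarrow> norm (F a) \<le> K"
      by (auto simp: bounded_iff)
    \<comment> \<open>\<open>G \<theta>\<close> is the test function for \<open>x\<close> at a
      frozen parameter. \<open>h\<close> applies it to restricted tuples of path values, so that for
      fixed \<open>\<theta>\<close> its integral is literally the reflection form of
      \<open>x\<close> at \<open>G \<theta>\<close>.\<close>
    define G where "G \<theta> a = F (\<lambda>i\<in>{..<n}. \<phi> \<theta> (a i))" for \<theta> and a :: "nat \<Rightarrow> real"
    define h where "h p \<theta> = G \<theta> (\<lambda>i\<in>{..<n}. p (t i)) * cnj (G \<theta> (\<lambda>i\<in>{..<n}. p (- t i)))"
      for p :: "real \<Rightarrow> real" and \<theta>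
    \<comment> \<open>The restricted tuple always lies in the domain on which \<open>K\<close>
      bounds \<open>F\<close>, so the bound is uniform in \<open>\<theta>\<close>.\<close>
    have G_bound: "norm (G \<theta> a) \<le> K" for \<theta> a
      unfolding G_def by (rule K) (auto simp: space_PiM)
    have h_measurable: "case_prod h \<in> borel_measurable (?path \<Otimes>\<^sub>M N)"
    proof -
      have [measurable]: "cnj \<in> borel_measurable borel"
        by (intro borel_measurable_continuous_onI continuous_intros)
      \<comment> \<open>Only the finitely many path coordinates \<open>s i\<close> enter, and each
        coordinate is measurable on the path space. The claim is used for the times \<open>t\<close>
        and for their reflections.\<close>
      have "(\<lambda>q. G (snd q) (\<lambda>i\<in>{..<n}. fst q (s i))) \<in> borel_measurable (?path \<Otimes>\<^sub>M N)"
        for s :: "nat \<Rightarrow> real"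
      proof -
        have [measurable]: "(\<lambda>q. \<phi> (snd q) (fst q r)) \<in> borel_measurable (?path \<Otimes>\<^sub>M N)" for r
        proof -
          have [measurable]: "(\<lambda>q. fst q r) \<in> borel_measurable (?path \<Otimes>\<^sub>M N)"
            by (rule measurable_compose[OF measurable_fst measurable_component_singleton]) simp
          show ?thesis by measurable
        qed
        show ?thesis
          unfolding G_def by (simp cong: restrict_cong) measurable
      qed
      from this[of t] this[of "\<lambda>i. - t i"] show ?thesis
        unfolding h_def split_beta' by measurable
    qed
    have h_bound: "norm (h p \<theta>) \<le> K * K" for p \<theta>
      unfolding h_def norm_mult complex_mod_cnj
      using G_bound order_trans[OF norm_ge_zero G_bound] by (intro mult_mono) auto
    have "(\<integral>w. F (\<lambda>i\<in>{..<n}. \<phi> (\<Theta> w) (x (t i) w)) *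
          cnj (F (\<lambda>i\<in>{..<n}. \<phi> (\<Theta> w) (x (- t i) w))) \<partial>M) =
        (\<integral>w. h (\<lambda>t. x t w) (\<Theta> w) \<partial>M)"
      by (simp add: h_def G_def cong: restrict_cong)
    also have "\<dots> = (\<integral>\<theta>. (\<integral>w. h (\<lambda>t. x t w) \<theta> \<partial>M) \<partial>distr M N \<Theta>)"
      using assms(4) h_bound
      by (intro integral_indep_set[OF path \<Theta> _ h_measurable]) (auto simp: indep_of_path_def)
    also have "\<dots> \<in> \<real>\<^sub>\<ge>\<^sub>0"
    proof (rule integral_in_nonneg_Reals)
      fix \<theta> assume "\<theta> \<in> space (distr M N \<Theta>)"
      then have [measurable]: "\<phi> \<theta> \<in> borel_measurable borel"
        by (simp add: network_measurable)
      have "G \<theta> \<in> borel_measurable (\<Pi>\<^sub>M i\<in>{..<n}. borel)"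
        unfolding G_def by measurable
      moreover have "bounded (G \<theta> ` space (\<Pi>\<^sub>M i\<in>{..<n}. (borel :: real measure)))"
        using G_bound by (auto simp: bounded_iff)
      \<comment> \<open>Reflection positivity of \<open>x\<close> is applied with the same
        \<open>n\<close> and \<open>t\<close> and the test function
        \<open>G \<theta>\<close>.\<close>
      ultimately show "(\<integral>w. h (\<lambda>t. x t w) \<theta> \<partial>M) \<in> \<real>\<^sub>\<ge>\<^sub>0"
        using assms(1) n t unfolding reflection_positive_def h_def by blast
    qed
    finally show "(\<integral>w. F (\<lambda>i\<in>{..<n}. \<phi> (\<Theta> w) (x (t i) w)) *
        cnj (F (\<lambda>i\<in>{..<n}. \<phi> (\<Theta> w) (x (- t i) w))) \<partial>M) \<in> \<real>\<^sub>\<ge>\<^sub>0" .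
  qed
qed

end
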